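(* For every finite subgroup $G$ of $PSL(2,\mathbb{C})$ there exists a rational 1-form $\eta$ on the Riemann sphere $\widehat{\mathbb{C}}$ whose isotropy group is exactly $G$, i.e. $\{T\in PSL(2,\mathbb{C}) : T_*\eta=\eta\}=G$.
   Context: $PSL(2,\mathbb{C})$ acts on $\widehat{\mathbb{C}}$ by Möbius transformations. For $T\in PSL(2,\mathbb{C})$ and a rational 1-form $\eta$, $T_*\eta=(T^{-1})^*\eta$ is the push-forward. The isotropy group of $\eta$ is $\{T\in PSL(2,\mathbb{C}) : T_*\eta=\eta\}$. *)

theory Defs
  imports
    "HOL-Analysis.Determinants"
    "HOL-Algebra.Coset"
    "HOL-Computational_Algebra.Field_as_Ring"
    "HOL-Computational_Algebra.Polynomial_Factorial"
begin

section \<open>The group PSL(2,C)\<close>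

definition SL2C :: "(complex ^ 2 ^ 2) monoid" where
  "SL2C = \<lparr>carrier = {A. det A = 1}, monoid.mult = (**), one = mat 1\<rparr>"

text \<open>Elements of \<open>PSL2C\<close> are the cosets \<open>{A, -A}\<close>.\<close>

definition PSL2C :: "(complex ^ 2 ^ 2) set monoid" where
  "PSL2C = SL2C Mod {mat 1, - mat 1}"

lemma det_uminus_2: "det (- A) = det (A :: complex ^ 2 ^ 2)"
  by (simp add: det_2)

lemma matrix_uminus_mult_2:
  fixes A B :: "complex ^ 2 ^ 2"
  shows "(- A) ** B = - (A ** B)" "A ** (- B) = - (A ** B)"
  by (simp_all add: matrix_matrix_mult_def vec_eq_iff sum_negf)

lemma group_SL2C: "group SL2C"
proof (rule groupI)
  fix A assume "A \<in> carrier SL2C"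
  then have A: "det A = 1" by (simp add: SL2C_def)
  then have "invertible A" by (simp add: invertible_det_nz)
  then obtain B where B: "A ** B = mat 1" "B ** A = mat 1"
    unfolding invertible_def by blast
  have "det (B ** A) = 1" using B by simp
  then have "det B = 1" using A by (simp add: det_mul)
  then show "\<exists>B \<in> carrier SL2C. B \<otimes>\<^bsub>SL2C\<^esub> A = \<one>\<^bsub>SL2C\<^esub>"
    using B by (auto simp: SL2C_def)
qed (auto simp: SL2C_def det_mul matrix_mul_assoc)

lemma normal_pm_one_SL2C: "{mat 1, - mat 1} \<lhd> SL2C"
proof -
  interpret group SL2C by (rule group_SL2C)
  have minus_inv: "inv\<^bsub>SL2C\<^esub> (- mat 1) = - mat 1"
    by (rule inv_equality)
      (simp_all add: SL2C_def det_uminus_2 matrix_uminus_mult_2)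
  have one_inv: "inv\<^bsub>SL2C\<^esub> (mat 1) = mat 1"
    by (rule inv_equality) (simp_all add: SL2C_def)
  have sub: "subgroup {mat 1, - mat 1} SL2C"
  proof (rule subgroupI)
    fix a :: "complex ^ 2 ^ 2" assume "a \<in> {mat 1, - mat 1}"
    then show "inv\<^bsub>SL2C\<^esub> a \<in> {mat 1, - mat 1}"
      using minus_inv one_inv by auto
  qed (auto simp: SL2C_def det_uminus_2 matrix_uminus_mult_2)
  show ?thesis
  proof (rule normalI[OF sub], rule ballI)
    fix A assume "A \<in> carrier SL2C"
    then show "{mat 1, - mat 1} #>\<^bsub>SL2C\<^esub> A = A <#\<^bsub>SL2C\<^esub> {mat 1, - mat 1}"
      by (auto simp: r_coset_def l_coset_def SL2C_def matrix_uminus_mult_2)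
  qed
qed

lemma group_PSL2C: "group PSL2C"
  unfolding PSL2C_def by (rule normal.factorgroup_is_group[OF normal_pm_one_SL2C])

lemma carrier_PSL2C: "carrier PSL2C = {{A, - A} | A. det A = 1}"
  by (auto simp: PSL2C_def FactGroup_def RCOSETS_def r_coset_def SL2C_def
      matrix_uminus_mult_2)


section \<open>Rational functions and rational 1-forms on the Riemann sphere\<close>

type_synonym rat_fun = "complex poly fract"

definition const_rat :: "complex \<Rightarrow> rat_fun" where
  "const_rat c = to_fract [:c:]"

definition poly_at_rat :: "complex poly \<Rightarrow> rat_fun \<Rightarrow> rat_fun" where
  "poly_at_rat p R = poly (map_poly const_rat p) R"

text \<open>
  The composition \<open>f \<circ> R\<close>. It is meaningful for non-constant \<open>R\<close>; a constant \<open>R\<close> may hit a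
  pole of \<open>f\<close>, and then division by zero makes the value \<open>0\<close>.
\<close>

definition rat_compose :: "rat_fun \<Rightarrow> rat_fun \<Rightarrow> rat_fun" where
  "rat_compose f R =
     (case quot_of_fract f of (p, q) \<Rightarrow> poly_at_rat p R / poly_at_rat q R)"

definition rat_deriv :: "rat_fun \<Rightarrow> rat_fun" where
  "rat_deriv f =
     (case quot_of_fract f of (p, q) \<Rightarrow> to_fract (pderiv p * q - p * pderiv q) / to_fract (q\<^sup>2))"

text \<open>
  \<open>Form f\<close> stands for the 1-form \<open>f(z) dz\<close>, where \<open>z\<close> is the affine coordinate of the sphere. Every
  rational 1-form is of this shape for exactly one \<open>f\<close>; in the coordinate \<open>w = 1/z\<close> at infinity it
  reads \<open>- f(1/w) / w\<^sup>2 dw\<close>.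
\<close>

datatype rat_form = Form (form_coeff: rat_fun)

text \<open>\<open>R\<^sup>*(f dz) = (f \<circ> R) dR\<close> with \<open>dR = R' dz\<close>.\<close>

definition form_pullback :: "rat_fun \<Rightarrow> rat_form \<Rightarrow> rat_form" where
  "form_pullback R \<eta> = Form (rat_compose (form_coeff \<eta>) R * rat_deriv R)"


section \<open>Moebius transformations acting on 1-forms\<close>

definition mobius_matrix :: "complex ^ 2 ^ 2 \<Rightarrow> rat_fun" where
  "mobius_matrix A = to_fract [:A$1$2, A$1$1:] / to_fract [:A$2$2, A$2$1:]"

text \<open>The common value of \<open>mobius_matrix\<close> on the representatives of \<open>T\<close>; see \<open>mobius_coset\<close>.\<close>

definition mobius :: "(complex ^ 2 ^ 2) set \<Rightarrow> rat_fun" where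
  "mobius T = the_elem (mobius_matrix ` T)"

definition form_pushforward :: "(complex ^ 2 ^ 2) set \<Rightarrow> rat_form \<Rightarrow> rat_form" where
  "form_pushforward T \<eta> = form_pullback (mobius (inv\<^bsub>PSL2C\<^esub> T)) \<eta>"

definition isotropy_group :: "rat_form \<Rightarrow> (complex ^ 2 ^ 2) set set" where
  "isotropy_group \<eta> = {T \<in> carrier PSL2C. form_pushforward T \<eta> = \<eta>}"

lemma mobius_matrix_uminus: "mobius_matrix (- A) = mobius_matrix A"
proof -
  have "to_fract [:- x, - y:] = - to_fract [:x, y:]" for x y :: complex
    by (simp flip: to_fract_uminus)
  then show ?thesis
    by (simp add: mobius_matrix_def)
qed

lemma mobius_coset: "mobius {A, - A} = mobius_matrix A"
  by (simp add: mobius_def mobius_matrix_uminus)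

lemma rat_deriv_quotient:
  assumes "q \<noteq> 0"
  shows "rat_deriv (to_fract p / to_fract q) =
           to_fract (pderiv p * q - p * pderiv q) / to_fract (q\<^sup>2)"
proof -
  have eq: "quot_of_fract (to_fract p / to_fract q) = normalize_quot (p, q)"
    using quot_of_fract_quot_to_fract[of "(p, q)"] assms
    by (simp add: quot_to_fract_def Fract_conv_to_fract)
  obtain d where d: "p = fst (normalize_quot (p, q)) * d" "q = snd (normalize_quot (p, q)) * d"
      "d \<noteq> 0"
    using normalize_quotE[OF assms] by metis
  obtain a b where ab: "normalize_quot (p, q) = (a, b)" by fastforce
  have p: "p = a * d" and q: "q = b * d" using d ab by auto
  have b: "b \<noteq> 0" using q assms by auto
  have "(pderiv a * b - a * pderiv b) * q\<^sup>2 = (pderiv p * q - p * pderiv q) * b\<^sup>2"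
    unfolding p q by (simp add: pderiv_mult algebra_simps power2_eq_square)
  then have "to_fract (pderiv a * b - a * pderiv b) * to_fract (q\<^sup>2) =
      to_fract (pderiv p * q - p * pderiv q) * to_fract (b\<^sup>2)"
    by (simp only: flip: to_fract_mult)
  then have "to_fract (pderiv a * b - a * pderiv b) / to_fract (b\<^sup>2) =
      to_fract (pderiv p * q - p * pderiv q) / to_fract (q\<^sup>2)"
    using assms b by (subst frac_eq_eq) auto
  then show ?thesis by (simp add: rat_deriv_def eq ab)
qed

lemma poly_at_rat_mult: "poly_at_rat (p * q) R = poly_at_rat p R * poly_at_rat q R"
proof -
  have hom: "const_rat 0 = 0" "const_rat (x + y) = const_rat x + const_rat y"
    "const_rat (x * y) = const_rat x * const_rat y" for x y
    by (simp_all add: const_rat_def flip: to_fract_add to_fract_mult)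
  have "map_poly const_rat (p * q) = map_poly const_rat p * map_poly const_rat q"
  proof (rule poly_eqI)
    fix n
    have sum: "const_rat (sum g I) = (\<Sum>i\<in>I. const_rat (g i))" for g and I :: "nat set"
      by (induction I rule: infinite_finite_induct) (simp_all add: hom)
    show "coeff (map_poly const_rat (p * q)) n =
        coeff (map_poly const_rat p * map_poly const_rat q) n"
      by (simp add: coeff_map_poly hom coeff_mult sum)
  qed
  then show ?thesis by (simp add: poly_at_rat_def)
qed

lemma rat_compose_quotient:
  assumes "poly_at_rat q R \<noteq> 0"
  shows "rat_compose (to_fract p / to_fract q) R = poly_at_rat p R / poly_at_rat q R"
proof -
  have q0: "q \<noteq> 0" using assms by (auto simp: poly_at_rat_def)
  have eq: "quot_of_fract (to_fract p / to_fract q) = normalize_quot (p, q)"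
    using quot_of_fract_quot_to_fract[of "(p, q)"] q0
    by (simp add: quot_to_fract_def Fract_conv_to_fract)
  obtain d where d: "p = fst (normalize_quot (p, q)) * d" "q = snd (normalize_quot (p, q)) * d"
    using normalize_quotE[OF q0] by metis
  obtain a b where ab: "normalize_quot (p, q) = (a, b)" by fastforce
  have p: "p = a * d" and q: "q = b * d" using d ab by auto
  show ?thesis
    using assms unfolding rat_compose_def eq ab by (simp add: p q poly_at_rat_mult)
qed

lemma rat_deriv_mobius_matrix:
  assumes "det A = 1"
  shows "rat_deriv (mobius_matrix A) = 1 / to_fract ([:A$2$2, A$2$1:]\<^sup>2)"
proof -
  have "[:A$2$2, A$2$1:] \<noteq> 0" using assms by (auto simp: det_2)
  moreover have "pderiv [:A$1$2, A$1$1:] * [:A$2$2, A$2$1:] -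
      [:A$1$2, A$1$1:] * pderiv [:A$2$2, A$2$1:] = [:det A:]"
    by (simp add: pderiv_pCons det_2 algebra_simps)
  ultimately show ?thesis
    using assms by (simp add: mobius_matrix_def rat_deriv_quotient one_pCons[symmetric])
qed

end

theory Submission
  imports Defs
begin

text \<open>
  To a row vector \<open>v = (a, b)\<close> belongs the 1-form \<open>\<omega>\<^sub>v = dz / (a z + b)\<^sup>2\<close>, whose only pole is a
  double pole. Pulling back along the Moebius map of a matrix \<open>A\<close> of determinant 1 turns \<open>\<omega>\<^sub>v\<close> into
  the form of \<open>v A\<close> (\<open>pullback_double_poles\<close>). A finite set \<open>S = - S\<close> of vectors in which
  parallel vectors agree up to sign can be read off from the sum of its forms, because the poles
  recover the lines and the principal parts recover the lengths up to sign
  (\<open>double_poles_eq_iff\<close>). So the isotropy group of this sum consists of the \<open>\<plusminus>B\<close> with \<open>S B = S\<close>,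
  and it remains to find an \<open>S\<close> with the prescribed finite stabiliser.

  Let \<open>H\<close> be the preimage of \<open>G\<close> in \<open>SL(2, \<complex>)\<close>, and let \<open>l\<close> be an eigenvector of no element of \<open>H\<close>
  except \<open>\<plusminus>1\<close> (\<open>generic_vector\<close>). If \<open>G\<close> is nontrivial, \<open>S = l H\<close> works: a matrix
  preserving \<open>S\<close> agrees, up to right multiplication by an element of \<open>H\<close>, with one that fixes \<open>l\<close> and
  preserves \<open>S\<close>. The double pole is what makes this matrix fix \<open>l\<close> as a vector, not only its line,
  so that it is unipotent; a unipotent matrix preserving a finite set that spans the plane is the
  identity (\<open>unipotent_trivial\<close>). For trivial \<open>G\<close> the orbit does not span the plane, and
  an explicit set of six vectors takes its place.
\<close>

section \<open>Row vectors under right multiplication by matrices\<close>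

definition cross :: "complex ^ 2 \<Rightarrow> complex ^ 2 \<Rightarrow> complex" where
  "cross u v = u$1 * v$2 - u$2 * v$1"

lemma vec_mult_nth_2:
  fixes v :: "complex ^ 2" and A :: "complex ^ 2 ^ 2"
  shows "(v v* A) $ j = v$1 * A$1$j + v$2 * A$2$j"
  by (simp add: vector_matrix_mult_def sum_2)

lemma cross_mult: "cross (u v* A) (v v* A) = det A * cross u v"
  by (simp add: cross_def vec_mult_nth_2 det_2 algebra_simps)

lemma cross_eq_0_iff_parallel:
  assumes "u \<noteq> 0"
  shows "cross u v = 0 \<longleftrightarrow> (\<exists>c. v = c *s u)"
proof
  assume *: "cross u v = 0"
  from assms have "u$1 \<noteq> 0 \<or> u$2 \<noteq> 0" by (auto simp: vec_eq_iff forall_2)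
  then show "\<exists>c. v = c *s u"
  proof
    assume "u$1 \<noteq> 0"
    with * have "v = (v$1 / u$1) *s u"
      by (auto simp: vec_eq_iff forall_2 cross_def field_simps)
    then show ?thesis by blast
  next
    assume "u$2 \<noteq> 0"
    with * have "v = (v$2 / u$2) *s u"
      by (auto simp: vec_eq_iff forall_2 cross_def field_simps)
    then show ?thesis by blast
  qed
qed (auto simp: cross_def)

lemma inj_row_action:
  assumes "det (A :: complex ^ 2 ^ 2) = 1"
  shows "inj (\<lambda>v. v v* A)"
proof -
  obtain B where "A ** B = mat 1"
    using assms invertible_det_nz[of A] unfolding invertible_def by auto
  then have "(v v* A) v* B = v" for v
    by (simp add: vector_matrix_mul_assoc)
  then show ?thesis by (metis injI)
qed

text \<open>
  A matrix of determinant 1 that fixes \<open>l\<close> moves \<open>m\<close> to \<open>m + c l\<close>, so the orbit of \<open>m\<close> is the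
  arithmetic progression \<open>m + n c l\<close>. It can stay in a finite set only for \<open>c = 0\<close>, and then two
  independent vectors are fixed.
\<close>

lemma unipotent_trivial:
  assumes "finite S" and perm: "\<And>s. s \<in> S \<Longrightarrow> s v* U \<in> S"
    and det: "det U = 1" and l: "l v* U = l" and m: "m \<in> S" "cross l m \<noteq> 0"
  shows "U = mat 1"
proof -
  have l0: "l \<noteq> 0" using m by (auto simp: cross_def)
  have "cross l (m v* U) = cross l m"
    using cross_mult[of l U m] det l by simp
  then have "cross l (m v* U - m) = 0" by (simp add: cross_def algebra_simps)
  then obtain c where "m v* U - m = c *s l"
    using l0 cross_eq_0_iff_parallel by blast
  then have c: "m v* U = m + c *s l" by (simp add: algebra_simps)
  have step: "(m + a *s l) v* U = m + (a + c) *s l" for a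
    unfolding vector_matrix_left_distrib scalar_vector_matrix_assoc c l
    by (simp add: algebra_simps)
  have orbit: "m + (of_nat n * c) *s l \<in> S" for n
  proof (induction n)
    case (Suc n)
    then show ?case using perm[OF Suc] unfolding step by (simp add: algebra_simps)
  qed (use m in simp)
  have "c = 0"
  proof (rule ccontr)
    assume "c \<noteq> 0"
    then have "inj (\<lambda>n::nat. m + (of_nat n * c) *s l)"
      using l0 by (intro injI) auto
    then have "infinite (range (\<lambda>n::nat. m + (of_nat n * c) *s l))"
      by (rule range_inj_infinite)
    moreover have "range (\<lambda>n::nat. m + (of_nat n * c) *s l) \<subseteq> S"
      using orbit by (simp add: image_subset_iff)
    ultimately show False using finite_subset[OF _ \<open>finite S\<close>] by metis
  qed
  with c have "m v* U = m" by simp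
  with l have e: "l$1 * (U$1$1 - 1) + l$2 * U$2$1 = 0" "m$1 * (U$1$1 - 1) + m$2 * U$2$1 = 0"
    "l$1 * U$1$2 + l$2 * (U$2$2 - 1) = 0" "m$1 * U$1$2 + m$2 * (U$2$2 - 1) = 0"
    by (auto simp: vec_eq_iff forall_2 vec_mult_nth_2 algebra_simps)
  have "cross l m * (U$1$1 - 1) = 0" "cross l m * U$2$1 = 0"
    "cross l m * U$1$2 = 0" "cross l m * (U$2$2 - 1) = 0"
    using e unfolding cross_def by algebra+
  then show ?thesis
    using m(2) by (auto simp: vec_eq_iff forall_2 mat_def)
qed

section \<open>Forms with double poles and their pullbacks\<close>

definition lin_poly :: "complex ^ 2 \<Rightarrow> complex poly" where
  "lin_poly v = [:v$2, v$1:]"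

text \<open>
  The term of \<open>v = (a, b)\<close> is \<open>1 / (a z + b)\<^sup>2\<close>. As the coefficient of a 1-form it has a single
  double pole, at \<open>[- b : a]\<close>, which is \<open>\<infinity>\<close> for \<open>a = 0\<close>, and neither zeros nor other poles; it
  depends on \<open>v\<close> up to sign.
\<close>

definition double_poles :: "(complex ^ 2) set \<Rightarrow> rat_fun" where
  "double_poles S = (\<Sum>v\<in>S. 1 / to_fract (lin_poly v) ^ 2)"

lemma lin_poly_eq_0_iff: "lin_poly v = 0 \<longleftrightarrow> v = 0"
  by (auto simp: lin_poly_def vec_eq_iff forall_2)

lemma poly_at_rat_simps:
  "poly_at_rat (p + q) R = poly_at_rat p R + poly_at_rat q R"
  "poly_at_rat 0 R = 0" "poly_at_rat 1 R = 1"
proof -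
  have "map_poly const_rat (p + q) = map_poly const_rat p + map_poly const_rat q"
    by (rule poly_eqI) (simp add: coeff_map_poly const_rat_def flip: to_fract_add)
  then show "poly_at_rat (p + q) R = poly_at_rat p R + poly_at_rat q R"
    by (simp add: poly_at_rat_def)
qed (simp_all add: poly_at_rat_def const_rat_def map_poly_pCons flip: one_pCons)

lemma poly_at_rat_sum: "poly_at_rat (sum f I) R = (\<Sum>i\<in>I. poly_at_rat (f i) R)"
  by (induction I rule: infinite_finite_induct) (simp_all add: poly_at_rat_simps)

lemma poly_at_rat_prod: "poly_at_rat (prod f I) R = (\<Prod>i\<in>I. poly_at_rat (f i) R)"
  by (induction I rule: infinite_finite_induct) (simp_all add: poly_at_rat_simps poly_at_rat_mult)

lemma to_fract_prod: "to_fract (prod f I) = (\<Prod>i\<in>I. to_fract (f i))"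
  by (induction I rule: infinite_finite_induct) simp_all

lemma sum_inverse_common_denominator:
  fixes h :: "'i \<Rightarrow> 'a :: field"
  assumes "finite I" and "\<And>i. i \<in> I \<Longrightarrow> h i \<noteq> 0"
  shows "(\<Sum>i\<in>I. \<Prod>j\<in>I - {i}. h j) / (\<Prod>i\<in>I. h i) = (\<Sum>i\<in>I. 1 / h i)"
  unfolding sum_divide_distrib
proof (rule sum.cong)
  fix i assume i: "i \<in> I"
  have "(\<Prod>j\<in>I. h j) = h i * (\<Prod>j\<in>I - {i}. h j)"
    using assms(1) i by (rule prod.remove)
  moreover have "(\<Prod>j\<in>I - {i}. h j) \<noteq> 0"
    using assms by auto
  ultimately show "(\<Prod>j\<in>I - {i}. h j) / (\<Prod>i\<in>I. h i) = 1 / h i"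
    using assms(2)[OF i] by simp
qed simp

text \<open>
  For \<open>w = (\<alpha> z + \<beta>) / (\<gamma> z + \<delta>)\<close> with determinant 1, \<open>dw = dz / (\<gamma> z + \<delta>)\<^sup>2\<close>, and the factor
  \<open>(\<gamma> z + \<delta>)\<^sup>2\<close> is exactly the one by which \<open>1 / (a w + b)\<^sup>2\<close> differs from the term of the row
  vector \<open>(a, b) A\<close>. The composition can be computed from any quotient whose denominator does not
  become 0 under the substitution; the common denominator of the sum has this property because each
  of its factors becomes the nonzero linear form of some \<open>v A\<close>, up to the denominator of \<open>w\<close>.
\<close>

lemma pullback_double_poles:
  assumes fin: "finite S" and "0 \<notin> S" and det: "det A = 1"
  shows "form_pullback (mobius_matrix A) (Form (double_poles S)) =
    Form (double_poles ((\<lambda>v. v v* A) ` S))"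
proof -
  let ?R = "mobius_matrix A" and ?L = "\<lambda>v. to_fract (lin_poly v)"
  let ?d = "to_fract [:A$2$2, A$2$1:]"
  have row2: "[:A$2$2, A$2$1:] \<noteq> 0" using det by (auto simp: det_2)
  have at_R: "poly_at_rat (lin_poly v) ?R = ?L (v v* A) / ?d" for v
  proof -
    have "lin_poly (v v* A) = [:v$1:] * [:A$1$2, A$1$1:] + [:v$2:] * [:A$2$2, A$2$1:]"
      by (simp add: lin_poly_def vec_mult_nth_2 algebra_simps)
    then have "?L (v v* A) = const_rat (v$1) * to_fract [:A$1$2, A$1$1:] + const_rat (v$2) * ?d"
      by (simp only: to_fract_add to_fract_mult const_rat_def)
    moreover have "poly_at_rat (lin_poly v) ?R = const_rat (v$2) + ?R * const_rat (v$1)"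
      by (simp add: poly_at_rat_def lin_poly_def map_poly_pCons const_rat_def)
    ultimately show ?thesis
      using row2 by (simp add: mobius_matrix_def field_simps)
  qed
  have nz: "v v* A \<noteq> 0" if "v \<in> S" for v
    using that \<open>0 \<notin> S\<close> inj_row_action[OF det] by (metis injD vector_matrix_mult_0)
  define h where "h v = lin_poly v ^ 2" for v
  define p where "p = (\<Sum>v\<in>S. \<Prod>w\<in>S - {v}. h w)"
  define q where "q = (\<Prod>v\<in>S. h v)"
  have h_at: "poly_at_rat (h v) ?R = (?L (v v* A) / ?d) ^ 2" for v
    by (simp add: h_def power2_eq_square poly_at_rat_mult at_R)
  have h_nz: "poly_at_rat (h v) ?R \<noteq> 0" if "v \<in> S" for v
    unfolding h_at using nz[OF that] row2 by (simp add: lin_poly_eq_0_iff)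
  have "double_poles S = (\<Sum>v\<in>S. 1 / to_fract (h v))"
    by (simp add: double_poles_def h_def power2_eq_square)
  also have "\<dots> = to_fract p / to_fract q"
    unfolding p_def q_def to_fract_sum to_fract_prod
    using fin \<open>0 \<notin> S\<close>
    by (intro sum_inverse_common_denominator[symmetric]) (auto simp: h_def lin_poly_eq_0_iff)
  finally have "rat_compose (double_poles S) ?R = poly_at_rat p ?R / poly_at_rat q ?R"
    using h_nz fin by (simp add: rat_compose_quotient q_def poly_at_rat_prod)
  also have "\<dots> = (\<Sum>v\<in>S. 1 / poly_at_rat (h v) ?R)"
    unfolding p_def q_def poly_at_rat_sum poly_at_rat_prod
    using fin h_nz by (rule sum_inverse_common_denominator)
  also have "\<dots> = (\<Sum>v\<in>S. 1 / ?L (v v* A) ^ 2) * ?d ^ 2"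
    unfolding sum_distrib_right h_at by (simp add: power_divide)
  also have "(\<Sum>v\<in>S. 1 / ?L (v v* A) ^ 2) = double_poles ((\<lambda>v. v v* A) ` S)"
    unfolding double_poles_def
    using inj_on_subset[OF inj_row_action[OF det]] by (subst sum.reindex) auto
  finally show ?thesis
    using row2 by (simp add: form_pullback_def rat_deriv_mobius_matrix[OF det] power2_eq_square
        del: mult_pCons_left mult_pCons_right)
qed

section \<open>The double poles determine the vectors\<close>

definition regular_at :: "complex \<Rightarrow> rat_fun \<Rightarrow> bool" where
  "regular_at z f \<longleftrightarrow> (\<exists>p q. f = to_fract p / to_fract q \<and> poly q z \<noteq> 0)"

lemma regular_at_0: "regular_at z 0"
  unfolding regular_at_def by (intro exI[of _ 0] exI[of _ 1]) simp

lemma regular_at_diff: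
  assumes "regular_at z f" "regular_at z g"
  shows "regular_at z (f - g)"
proof -
  obtain p q r s where *: "f = to_fract p / to_fract q" "poly q z \<noteq> 0"
    "g = to_fract r / to_fract s" "poly s z \<noteq> 0"
    using assms unfolding regular_at_def by blast
  then have "q \<noteq> 0" "s \<noteq> 0" by auto
  then have "f - g = to_fract (p * s - r * q) / to_fract (q * s)"
    using * by (simp add: diff_frac_eq)
  with * show ?thesis unfolding regular_at_def
    by (intro exI[of _ "p * s - r * q"] exI[of _ "q * s"]) simp
qed

lemma regular_at_add:
  assumes "regular_at z f" "regular_at z g"
  shows "regular_at z (f + g)"
  using regular_at_diff[OF assms(1) regular_at_diff[OF regular_at_0 assms(2)]] by simp

lemma regular_at_sum:
  assumes "\<And>i. i \<in> I \<Longrightarrow> regular_at z (f i)"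
  shows "regular_at z (\<Sum>i\<in>I. f i)"
  using assms
  by (induction I rule: infinite_finite_induct) (simp_all add: regular_at_0 regular_at_add)

lemma double_pole_not_regular:
  assumes "regular_at z (to_fract [:c:] / to_fract p ^ 2)" "poly p z = 0" "p \<noteq> 0"
  shows "c = 0"
proof -
  obtain r s where *: "to_fract [:c:] / to_fract (p ^ 2) = to_fract r / to_fract s" "poly s z \<noteq> 0"
    using assms(1) unfolding regular_at_def by (auto simp: power2_eq_square)
  then have "s \<noteq> 0" by auto
  with * assms(3) have "to_fract ([:c:] * s) = to_fract (r * p ^ 2)"
    by (simp add: frac_eq_eq power2_eq_square mult_ac del: to_fract_mult add: to_fract_mult[symmetric])
  then have "[:c:] * s = r * p ^ 2" by (simp only: to_fract_eq_iff)
  then have "poly ([:c:] * s) z = poly (r * p ^ 2) z" by (simp only:)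
  with * assms(2) show ?thesis by simp
qed

text \<open>
  Over such a set, only the terms of \<open>s\<close> and \<open>- s\<close> in \<open>double_poles\<close> share a pole, and being equal
  they do not cancel.
\<close>

definition separated :: "(complex ^ 2) set \<Rightarrow> bool" where
  "separated S \<longleftrightarrow> finite S \<and> 0 \<notin> S \<and> (\<forall>s\<in>S. - s \<in> S) \<and>
     (\<forall>s\<in>S. \<forall>t\<in>S. cross s t = 0 \<longrightarrow> t = s \<or> t = - s)"

lemma separated_image:
  assumes "separated S" "det A = 1"
  shows "separated ((\<lambda>v. v v* A) ` S)"
proof -
  have "(- s) v* A = - (s v* A)" for s
    by (simp add: vec_eq_iff vec_mult_nth_2)
  then show ?thesis
    using assms inj_row_action[OF assms(2)] unfolding separated_def
    by (auto simp: cross_mult) (metis injD vector_matrix_mult_0, metis imageI)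
qed


text \<open>The principal part at the root of \<open>lin_poly s\<close> comes from the vectors parallel to \<open>s\<close> alone.\<close>

lemma regular_at_double_poles_diff_parallel:
  assumes "finite S" and s: "s$1 \<noteq> 0"
  shows "regular_at (- s$2 / s$1) (double_poles S - double_poles {u \<in> S. cross s u = 0})"
proof -
  have "double_poles S - double_poles {u \<in> S. cross s u = 0} =
      (\<Sum>u\<in>S - {u \<in> S. cross s u = 0}. 1 / to_fract (lin_poly u) ^ 2)"
    unfolding double_poles_def using \<open>finite S\<close> by (subst sum_diff) auto
  also have "regular_at (- s$2 / s$1) \<dots>"
  proof (rule regular_at_sum)
    fix u assume "u \<in> S - {u \<in> S. cross s u = 0}"
    then have "poly (lin_poly u) (- s$2 / s$1) \<noteq> 0"
      using s by (auto simp: lin_poly_def cross_def field_simps)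
    then show "regular_at (- s$2 / s$1) (1 / to_fract (lin_poly u) ^ 2)"
      unfolding regular_at_def
      by (intro exI[of _ 1] exI[of _ "lin_poly u ^ 2"]) (simp add: power2_eq_square)
  qed
  finally show ?thesis .
qed

lemma double_poles_pair:
  assumes "s \<noteq> 0" "c \<noteq> 0"
  shows "double_poles {c *s s, - (c *s s)} = to_fract [:2 / c\<^sup>2:] / to_fract (lin_poly s) ^ 2"
proof -
  have two: "to_fract [:2:] = 1 + 1"
    by (simp flip: to_fract_1 to_fract_add add: one_pCons)
  have "c *s s \<noteq> - (c *s s)"
    using assms by (auto simp: vec_eq_iff forall_2)
  then have "double_poles {c *s s, - (c *s s)} =
      1 / to_fract (lin_poly (c *s s)) ^ 2 + 1 / to_fract (lin_poly (- (c *s s))) ^ 2"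
    by (simp add: double_poles_def)
  also have "lin_poly (- (c *s s)) = - lin_poly (c *s s)"
    by (simp add: lin_poly_def)
  also have "lin_poly (c *s s) = [:c:] * lin_poly s"
    by (simp add: lin_poly_def)
  also have "1 / to_fract ([:c:] * lin_poly s) ^ 2 + 1 / to_fract (- ([:c:] * lin_poly s)) ^ 2 =
      to_fract [:2:] / (to_fract [:c:] ^ 2 * to_fract (lin_poly s) ^ 2)"
    by (simp add: power_mult_distrib two del: mult_pCons_left)
  also have "\<dots> = to_fract [:2 / c\<^sup>2:] / to_fract (lin_poly s) ^ 2"
  proof -
    have "to_fract [:2:] = to_fract ([:2 / c\<^sup>2:] * [:c:] * [:c:])"
      using assms by (simp add: power2_eq_square)
    then have "to_fract [:2:] = to_fract [:2 / c\<^sup>2:] * to_fract [:c:] ^ 2"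
      by (simp only: to_fract_mult power2_eq_square mult.assoc)
    then show ?thesis using assms by simp
  qed
  finally show ?thesis .
qed

lemma separated_parallel:
  assumes "separated S" "s \<in> S"
  shows "{u \<in> S. cross s u = 0} = {s, - s}"
  using assms by (auto simp: separated_def cross_def)

text \<open>
  Compare the principal parts at the pole of \<open>s\<close>. On the side of \<open>S\<close> it is that of \<open>2 / L\<^sup>2\<close> with
  \<open>L\<close> the linear form of \<open>s\<close>, so \<open>S'\<close> must contain some \<open>c s\<close>, which contributes \<open>2 / (c\<^sup>2 L\<^sup>2)\<close>.
  Hence \<open>c\<^sup>2 = 1\<close>, and \<open>s\<close> itself lies in the symmetric set \<open>S'\<close>.
\<close>

lemma double_poles_mem_finite_pole:
  assumes S: "separated S" and S': "separated S'" and eq: "double_poles S = double_poles S'"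
    and s: "s \<in> S" "s$1 \<noteq> 0"
  shows "s \<in> S'"
proof -
  let ?t = "- s$2 / s$1" and ?L = "to_fract (lin_poly s)"
  have s0: "s \<noteq> 0" using s(2) by auto
  have root: "poly (lin_poly s) ?t = 0" using s(2) by (simp add: lin_poly_def)
  have fin: "finite S" "finite S'" using S S' by (auto simp: separated_def)
  define P' where "P' = {u \<in> S'. cross s u = 0}"
  have "regular_at ?t (double_poles S - double_poles P' - (double_poles S - double_poles {s, - s}))"
    using regular_at_diff[OF regular_at_double_poles_diff_parallel[OF fin(2) s(2)]
      regular_at_double_poles_diff_parallel[OF fin(1) s(2)]] eq
    by (simp add: separated_parallel[OF S s(1)] P'_def)
  then have "regular_at ?t (double_poles {1 *s s, - (1 *s s)} - double_poles P')"
    by (simp add: algebra_simps)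
  then have reg: "regular_at ?t (to_fract [:2:] / ?L ^ 2 - double_poles P')"
    unfolding double_poles_pair[OF s0 one_neq_zero] by simp
  have "P' \<noteq> {}"
  proof
    assume "P' = {}"
    then have "regular_at ?t (to_fract [:2:] / ?L ^ 2)"
      using reg by (simp add: double_poles_def)
    from double_pole_not_regular[OF this root] show False
      using s0 by (simp add: lin_poly_eq_0_iff)
  qed
  then obtain u where u: "u \<in> S'" "cross s u = 0" by (auto simp: P'_def)
  then obtain c where c: "u = c *s s"
    using cross_eq_0_iff_parallel[OF s0] by blast
  have c0: "c \<noteq> 0" using u(1) S' c by (auto simp: separated_def)
  have "P' = {v \<in> S'. cross u v = 0}"
    using c c0 by (auto simp: P'_def cross_def)
  then have "P' = {c *s s, - (c *s s)}"
    using separated_parallel[OF S' u(1)] c by simp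
  then have "regular_at ?t (to_fract [:2:] / ?L ^ 2 - to_fract [:2 / c\<^sup>2:] / ?L ^ 2)"
    using reg double_poles_pair[OF s0 c0] by simp
  then have "regular_at ?t (to_fract [:2 - 2 / c\<^sup>2:] / ?L ^ 2)"
    by (simp flip: diff_divide_distrib to_fract_diff)
  from double_pole_not_regular[OF this root] have "2 - 2 / c\<^sup>2 = 0"
    using s0 by (simp add: lin_poly_eq_0_iff)
  then have "c\<^sup>2 = 1" using c0 by (simp add: field_simps)
  then have "s = u \<or> s = - u" using c by (auto simp: power2_eq_1_iff)
  then show ?thesis using u(1) S' by (auto simp: separated_def)
qed

lemma double_poles_subset:
  assumes S: "separated S" and S': "separated S'" and eq: "double_poles S = double_poles S'"
  shows "S \<subseteq> S'"
proof
  fix s assume s: "s \<in> S"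
  show "s \<in> S'"
  proof (cases "s$1 = 0")
    case False
    then show ?thesis using double_poles_mem_finite_pole[OF S S' eq s] by blast
  next
    case True
    \<comment> \<open>The pole lies at infinity; the pullback under \<open>z \<mapsto> - 1 / z\<close> brings it to 0.\<close>
    define R :: "complex ^ 2 ^ 2" where "R = vector [vector [0, -1], vector [1, 0]]"
    have det: "det R = 1" by (simp add: R_def det_2)
    let ?im = "\<lambda>S. (\<lambda>v. v v* R) ` S"
    have "s \<noteq> 0" using s S by (auto simp: separated_def)
    with True have "(s v* R)$1 \<noteq> 0" by (auto simp: vec_mult_nth_2 R_def vec_eq_iff forall_2)
    moreover have "double_poles (?im S) = double_poles (?im S')"
      using pullback_double_poles[OF _ _ det] S S' eq
      by (metis rat_form.inject separated_def)
    ultimately have "s v* R \<in> ?im S'"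
      using double_poles_mem_finite_pole[OF separated_image[OF S det] separated_image[OF S' det]] s
      by blast
    then show ?thesis using inj_image_mem_iff[OF inj_row_action[OF det]] by blast
  qed
qed

lemma double_poles_eq_iff:
  assumes "separated S" "separated S'"
  shows "double_poles S = double_poles S' \<longleftrightarrow> S = S'"
  using double_poles_subset[OF assms] double_poles_subset[OF assms(2,1)] by auto

text \<open>
  The push-forward by \<open>T\<close> is the pullback by a representative \<open>B\<close> of the inverse of \<open>T\<close>, hence the
  condition on \<open>B\<close>; a subgroup contains \<open>T\<close> iff it contains the inverse.
\<close>

lemma isotropy_group_double_poles:
  assumes S: "separated S" and G: "subgroup G PSL2C"
    and stab: "\<And>B. det B = 1 \<Longrightarrow> (\<lambda>v. v v* B) ` S = S \<longleftrightarrow> {B, - B} \<in> G"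
  shows "isotropy_group (Form (double_poles S)) = G"
proof -
  interpret group PSL2C by (rule group_PSL2C)
  interpret G: subgroup G PSL2C by (rule G)
  have "form_pushforward T (Form (double_poles S)) = Form (double_poles S) \<longleftrightarrow> T \<in> G"
    if T: "T \<in> carrier PSL2C" for T
  proof -
    have "inv\<^bsub>PSL2C\<^esub> T \<in> carrier PSL2C" using T by simp
    then obtain B where B: "inv\<^bsub>PSL2C\<^esub> T = {B, - B}" "det B = 1"
      unfolding carrier_PSL2C by blast
    have "form_pushforward T (Form (double_poles S)) = Form (double_poles ((\<lambda>v. v v* B) ` S))"
      unfolding form_pushforward_def B(1) mobius_coset
      using S B(2) by (intro pullback_double_poles) (auto simp: separated_def)
    then have "form_pushforward T (Form (double_poles S)) = Form (double_poles S) \<longleftrightarrow>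
        (\<lambda>v. v v* B) ` S = S"
      using double_poles_eq_iff[OF separated_image[OF S B(2)] S] by simp
    also have "\<dots> \<longleftrightarrow> inv\<^bsub>PSL2C\<^esub> T \<in> G" using stab B by simp
    also have "\<dots> \<longleftrightarrow> T \<in> G" using T by (metis G.m_inv_closed inv_inv)
    finally show ?thesis .
  qed
  then show ?thesis
    using G.subset by (auto simp: isotropy_group_def)
qed

section \<open>Finite subgroups as stabilisers of finite sets of vectors\<close>

definition SL2C_preimage :: "(complex ^ 2 ^ 2) set set \<Rightarrow> (complex ^ 2 ^ 2) set" where
  "SL2C_preimage G = {A. det A = 1 \<and> {A, - A} \<in> G}"

lemma finite_SL2C_preimage: "finite G \<Longrightarrow> finite (SL2C_preimage G)"
proof -
  assume "finite G"
  have "SL2C_preimage G \<subseteq> \<Union>(G \<inter> {{A, - A} |A. True})" unfolding SL2C_preimage_def by blast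
  moreover have "finite (\<Union>(G \<inter> {{A, - A} |A. True}))"
    using \<open>finite G\<close> by (intro finite_Union) auto
  ultimately show ?thesis by (rule finite_subset)
qed

lemma PSL2C_mult: "{A, - A} \<otimes>\<^bsub>PSL2C\<^esub> {B, - B} = {A ** B, - (A ** B)}"
  by (auto simp: PSL2C_def FactGroup_def set_mult_def SL2C_def matrix_uminus_mult_2)

lemma PSL2C_one: "\<one>\<^bsub>PSL2C\<^esub> = {mat 1, - mat 1}"
  by (simp add: PSL2C_def FactGroup_def)

lemma pm_eq_iff: "{A, - A} = {B, - B} \<longleftrightarrow> A = B \<or> A = - (B :: complex ^ 2 ^ 2)"
  by (auto simp: doubleton_eq_iff)

lemma SL2C_preimage_uminus: "A \<in> SL2C_preimage G \<Longrightarrow> - A \<in> SL2C_preimage G"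
  by (simp add: SL2C_preimage_def det_uminus_2 insert_commute)

lemma SL2C_preimage_one: "subgroup G PSL2C \<Longrightarrow> mat 1 \<in> SL2C_preimage G"
  using subgroup.one_closed[of G PSL2C] by (simp add: SL2C_preimage_def PSL2C_one)

lemma SL2C_preimage_mult:
  assumes "subgroup G PSL2C" "A \<in> SL2C_preimage G" "B \<in> SL2C_preimage G"
  shows "A ** B \<in> SL2C_preimage G"
  using assms subgroup.m_closed[OF assms(1), of "{A, - A}" "{B, - B}"]
  by (simp add: SL2C_preimage_def PSL2C_mult det_mul)

lemma SL2C_preimage_inverse:
  assumes "subgroup G PSL2C" "A \<in> SL2C_preimage G"
  obtains B where "B \<in> SL2C_preimage G" "A ** B = mat 1" "B ** A = mat 1"
proof -
  interpret group PSL2C by (rule group_PSL2C)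
  interpret G: subgroup G PSL2C by (rule assms)
  have "{A, - A} \<in> G" using assms by (simp add: SL2C_preimage_def)
  then have inv: "inv\<^bsub>PSL2C\<^esub> {A, - A} \<in> G" and
    mult: "{A, - A} \<otimes>\<^bsub>PSL2C\<^esub> inv\<^bsub>PSL2C\<^esub> {A, - A} = {mat 1, - mat 1}"
    by (simp_all flip: PSL2C_one)
  then obtain B where B: "inv\<^bsub>PSL2C\<^esub> {A, - A} = {B, - B}" "det B = 1"
    using G.subset unfolding carrier_PSL2C by blast
  then have BL: "B \<in> SL2C_preimage G" "- B \<in> SL2C_preimage G"
    using inv SL2C_preimage_uminus by (simp_all add: SL2C_preimage_def)
  have "A ** B = mat 1 \<or> A ** B = - mat 1"
    using mult unfolding B PSL2C_mult pm_eq_iff .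
  then have "A ** B = mat 1 \<or> A ** (- B) = mat 1"
    by (auto simp: matrix_uminus_mult_2)
  then show ?thesis
    using BL that matrix_left_right_inverse by metis
qed

text \<open>
  A matrix of determinant 1 other than \<open>\<plusminus>1\<close> has at most two eigenlines, cut out in the family of
  vectors \<open>(1, t)\<close> by a nonzero polynomial in \<open>t\<close> of degree at most 2.
\<close>

lemma generic_vector:
  fixes H :: "(complex ^ 2 ^ 2) set"
  assumes "finite H" and det: "\<And>A. A \<in> H \<Longrightarrow> det A = 1"
  obtains l where "\<And>A. A \<in> H \<Longrightarrow> cross l (l v* A) = 0 \<Longrightarrow> A = mat 1 \<or> A = - mat 1"
proof -
  define q :: "complex ^ 2 ^ 2 \<Rightarrow> complex poly"
    where "q A = [:A$1$2, A$2$2 - A$1$1, - A$2$1:]" for A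
  have "finite (\<Union>A\<in>{A \<in> H. q A \<noteq> 0}. {t. poly (q A) t = 0})"
    using assms(1) poly_roots_finite by auto
  then obtain t where t: "\<And>A. A \<in> H \<Longrightarrow> poly (q A) t = 0 \<Longrightarrow> q A = 0"
    using ex_new_if_finite[OF infinite_UNIV_char_0, of "\<Union>A\<in>{A \<in> H. q A \<noteq> 0}. {t. poly (q A) t = 0}"]
    by blast
  define l :: "complex ^ 2" where "l = vector [1, t]"
  show ?thesis
  proof (rule that)
    fix A assume A: "A \<in> H" and par: "cross l (l v* A) = 0"
    have "cross l (l v* A) = poly (q A) t"
      by (simp add: cross_def l_def vec_mult_nth_2 q_def algebra_simps)
    with t[OF A] par have *: "A$1$2 = 0" "A$2$1 = 0" "A$2$2 = A$1$1"
      by (auto simp: q_def)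
    with det[OF A] have "A$1$1 ^ 2 = 1" by (simp add: det_2 power2_eq_square)
    with * show "A = mat 1 \<or> A = - mat 1"
      by (auto simp: vec_eq_iff forall_2 mat_def power2_eq_1_iff)
  qed
qed

text \<open>
  If \<open>B\<close> preserves the orbit of \<open>l\<close>, then \<open>l B = l A\<close> for some \<open>A\<close> in the group, and \<open>B A\<^sup>-\<^sup>1\<close> fixes
  \<open>l\<close> and preserves the orbit, which contains a vector not parallel to \<open>l\<close> because the group is
  nontrivial. So \<open>B = A\<close> by \<open>unipotent_trivial\<close>.
\<close>

lemma isotropy_group_orbit:
  assumes G: "subgroup G PSL2C" and "finite G"
    and l: "\<And>A. A \<in> SL2C_preimage G \<Longrightarrow> cross l (l v* A) = 0 \<Longrightarrow> A = mat 1 \<or> A = - mat 1"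
    and nontriv: "\<not> SL2C_preimage G \<subseteq> {mat 1, - mat 1}"
  shows "isotropy_group (Form (double_poles ((\<lambda>A. l v* A) ` SL2C_preimage G))) = G"
proof (rule isotropy_group_double_poles[OF _ G])
  let ?S = "(\<lambda>A. l v* A) ` SL2C_preimage G"
  have det: "A \<in> SL2C_preimage G \<Longrightarrow> det A = 1" for A by (simp add: SL2C_preimage_def)
  obtain M where M: "M \<in> SL2C_preimage G" "cross l (l v* M) \<noteq> 0" using nontriv l by auto
  then have l0: "l \<noteq> 0" by (auto simp: cross_def)
  have "l v* A \<noteq> 0" if "A \<in> SL2C_preimage G" for A
    using l0 injD[OF inj_row_action[OF det[OF that]], of l 0] by auto
  then have "0 \<notin> ?S" by (metis imageE)
  moreover have "- s \<in> ?S" if s: "s \<in> ?S" for s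
  proof -
    obtain A where "A \<in> SL2C_preimage G" "s = l v* A" using s by blast
    then have "- A \<in> SL2C_preimage G" "- s = l v* (- A)"
      by (auto simp: SL2C_preimage_uminus vec_eq_iff vec_mult_nth_2)
    then show ?thesis by blast
  qed
  moreover have "t = s \<or> t = - s" if "s \<in> ?S" "t \<in> ?S" "cross s t = 0" for s t
  proof -
    obtain A B where AB: "A \<in> SL2C_preimage G" "s = l v* A" "B \<in> SL2C_preimage G" "t = l v* B"
      using \<open>s \<in> ?S\<close> \<open>t \<in> ?S\<close> by blast
    obtain A' where A': "A' \<in> SL2C_preimage G" "A ** A' = mat 1" "A' ** A = mat 1"
      using SL2C_preimage_inverse[OF G AB(1)] by blast
    have "cross (s v* A') (t v* A') = 0"
      using that(3) by (simp add: cross_mult)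
    then have "cross l (l v* (B ** A')) = 0"
      using AB A' by (simp add: vector_matrix_mul_assoc)
    then have "B ** A' = mat 1 \<or> B ** A' = - mat 1"
      using l SL2C_preimage_mult[OF G AB(3) A'(1)] by blast
    then have "B ** A' ** A = A \<or> B ** A' ** A = - A"
      by (auto simp: matrix_uminus_mult_2)
    then have "B = A \<or> B = - A"
      using A' by (simp flip: matrix_mul_assoc)
    then show ?thesis
      using AB by (auto simp: vec_eq_iff vec_mult_nth_2)
  qed
  ultimately show "separated ?S"
    using finite_SL2C_preimage[OF \<open>finite G\<close>] unfolding separated_def by blast
  fix B :: "complex ^ 2 ^ 2" assume detB: "det B = 1"
  have right: "(\<lambda>v. v v* C) ` ?S = ?S" if C: "C \<in> SL2C_preimage G" for C
  proof -
    have "(\<lambda>v. v v* C) ` ?S \<subseteq> ?S"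
      using SL2C_preimage_mult[OF G _ C] by (auto simp: vector_matrix_mul_assoc)
    then show ?thesis
      using finite_SL2C_preimage[OF \<open>finite G\<close>] inj_row_action[OF det[OF C]]
      by (intro endo_inj_surj) (auto intro: inj_on_subset)
  qed
  show "(\<lambda>v. v v* B) ` ?S = ?S \<longleftrightarrow> {B, - B} \<in> G"
  proof
    assume "{B, - B} \<in> G"
    then show "(\<lambda>v. v v* B) ` ?S = ?S" using right detB by (simp add: SL2C_preimage_def)
  next
    assume SB: "(\<lambda>v. v v* B) ` ?S = ?S"
    have lS: "l \<in> ?S" using SL2C_preimage_one[OF G] by (force simp: image_iff)
    then have "l v* B \<in> ?S" using SB by blast
    then obtain A where A: "A \<in> SL2C_preimage G" "l v* B = l v* A" by blast
    obtain A' where A': "A' \<in> SL2C_preimage G" "A ** A' = mat 1" "A' ** A = mat 1"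
      using SL2C_preimage_inverse[OF G A(1)] by blast
    have "B ** A' = mat 1"
    proof (rule unipotent_trivial)
      show "finite ?S" using finite_SL2C_preimage[OF \<open>finite G\<close>] by simp
      show "s v* (B ** A') \<in> ?S" if "s \<in> ?S" for s
        using that SB right[OF A'(1)] by (metis imageI vector_matrix_mul_assoc)
      show "det (B ** A') = 1" using detB det[OF A'(1)] by (simp add: det_mul)
      show "l v* (B ** A') = l"
        using A A' by (metis vector_matrix_mul_assoc vector_matrix_mul_rid)
      show "l v* M \<in> ?S" using M by blast
    qed (rule M)
    then have "B = A"
      using A'(3) by (metis matrix_mul_assoc matrix_mul_lid matrix_mul_rid)
    then show "{B, - B} \<in> G" using A by (simp add: SL2C_preimage_def)
  qed
qed

text \<open>
  For the trivial group a single orbit \<open>{l, - l}\<close> would leave all parabolic maps fixing the pole in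
  the isotropy group. Three pairs of vectors do instead: the determinants of pairs taken from
  \<open>(1, 0)\<close>, \<open>(0, 1)\<close>, \<open>(2, 3)\<close> are 1, 3 and 2 up to sign, so a matrix of determinant 1 that permutes
  the pairs permutes none of them with another; and a matrix preserving three lines is scalar.
\<close>

lemma isotropy_group_trivial:
  "\<exists>\<eta>. isotropy_group \<eta> = {{mat 1, - mat 1}}"
proof -
  define L :: "(complex \<times> complex) set"
    where "L = {(1, 0), (-1, 0), (0, 1), (0, -1), (2, 3), (-2, -3)}"
  define S :: "(complex ^ 2) set" where "S = {v. (v$1, v$2) \<in> L}"
  have "S = (\<lambda>(x, y). vector [x, y]) ` L"
  proof
    show "S \<subseteq> (\<lambda>(x, y). vector [x, y]) ` L"
    proof
      fix v assume "v \<in> S"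
      moreover have "v = (\<lambda>(x, y). vector [x, y]) (v$1, v$2)"
        by (simp add: vec_eq_iff forall_2)
      ultimately show "v \<in> (\<lambda>(x, y). vector [x, y]) ` L" unfolding S_def by blast
    qed
  qed (auto simp: S_def)
  then have "finite S" by (simp add: L_def)
  moreover have "0 \<notin> S" by (simp add: S_def L_def)
  moreover have uminus: "- s \<in> S" if s: "s \<in> S" for s
  proof -
    have "(- fst x, - snd x) \<in> L" if "x \<in> L" for x
      using that unfolding L_def by (elim insertE emptyE) simp_all
    from this[of "(s$1, s$2)"] s show ?thesis by (simp add: S_def)
  qed
  moreover have "t = s \<or> t = - s" if "s \<in> S" "t \<in> S" "cross s t = 0" for s t
  proof -
    have "y = x \<or> y = (- fst x, - snd x)"
      if "x \<in> L" "y \<in> L" "fst x * snd y - snd x * fst y = 0" for x y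
      using that unfolding L_def by (elim insertE emptyE) simp_all
    from this[of "(s$1, s$2)" "(t$1, t$2)"] that show ?thesis
      by (simp add: S_def cross_def vec_eq_iff forall_2)
  qed
  ultimately have "separated S" by (simp add: separated_def)
  moreover have "subgroup {{mat 1, - mat 1}} PSL2C"
    using group.triv_subgroup[OF group_PSL2C] by (simp add: PSL2C_one)
  moreover have "(\<lambda>v. v v* B) ` S = S \<longleftrightarrow> {B, - B} \<in> {{mat 1, - mat 1}}" if "det B = 1" for B
  proof
    assume "{B, - B} \<in> {{mat 1, - mat 1}}"
    then have "B = mat 1 \<or> B = - mat 1" by (simp add: pm_eq_iff)
    moreover have "v v* (- mat 1) = - v" for v :: "complex ^ 2"
      by (simp add: vec_eq_iff vec_mult_nth_2 mat_def forall_2)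
    moreover have "uminus ` S = S"
      using uminus by (force simp: image_iff)
    ultimately show "(\<lambda>v. v v* B) ` S = S" by auto
  next
    assume "(\<lambda>v. v v* B) ` S = S"
    then have "vector [x, y] v* B \<in> S" if "(x, y) \<in> L" for x y
      using that by (auto simp: S_def)
    from this[of 1 0] this[of 0 1] this[of 2 3]
    have rows: "(B$1$1, B$1$2) \<in> L" "(B$2$1, B$2$2) \<in> L"
      "(2 * B$1$1 + 3 * B$2$1, 2 * B$1$2 + 3 * B$2$2) \<in> L"
      by (auto simp: S_def vec_mult_nth_2 L_def)
    have "(x, y) \<in> {((1, 0), (0, 1)), ((-1, 0), (0, -1)), ((0, 1), (-1, 0)), ((0, -1), (1, 0))}"
      if "x \<in> L" "y \<in> L" "fst x * snd y - snd x * fst y = 1" for x y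
      using that unfolding L_def by (elim insertE emptyE) simp_all
    from this[OF rows(1,2)] \<open>det B = 1\<close>
    have "((B$1$1, B$1$2), (B$2$1, B$2$2)) \<in>
        {((1, 0), (0, 1)), ((-1, 0), (0, -1)), ((0, 1), (-1, 0)), ((0, -1), (1, 0))}"
      by (simp add: det_2)
    then have "B = mat 1 \<or> B = - mat 1"
      using rows(3) by (elim insertE emptyE) (simp_all add: L_def vec_eq_iff forall_2 mat_def)
    then show "{B, - B} \<in> {{mat 1, - mat 1}}" by (simp add: pm_eq_iff)
  qed
  ultimately have "isotropy_group (Form (double_poles S)) = {{mat 1, - mat 1}}"
    by (rule isotropy_group_double_poles)
  then show ?thesis by blast
qed

theorem mainTheorem1:
  fixes G :: "(complex ^ 2 ^ 2) set set"
  assumes "subgroup G PSL2C"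
    and "finite G"
  shows "\<exists>\<eta> :: rat_form. isotropy_group \<eta> = G"
proof (cases "SL2C_preimage G \<subseteq> {mat 1, - mat 1}")
  case False
  have "det A = 1" if "A \<in> SL2C_preimage G" for A using that by (simp add: SL2C_preimage_def)
  with generic_vector[OF finite_SL2C_preimage[OF assms(2)]] obtain l
    where "\<And>A. A \<in> SL2C_preimage G \<Longrightarrow> cross l (l v* A) = 0 \<Longrightarrow> A = mat 1 \<or> A = - mat 1"
    by blast
  then show ?thesis using isotropy_group_orbit[OF assms _ False] by blast
next
  case True
  have "G = {{mat 1, - mat 1}}"
  proof
    show "{{mat 1, - mat 1}} \<subseteq> G"
      using subgroup.one_closed[OF assms(1)] by (simp add: PSL2C_one)
    show "G \<subseteq> {{mat 1, - mat 1}}"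
    proof
      fix T assume "T \<in> G"
      then obtain A where "T = {A, - A}" "A \<in> SL2C_preimage G"
        using subgroup.subset[OF assms(1)] by (auto simp: carrier_PSL2C SL2C_preimage_def)
      then show "T \<in> {{mat 1, - mat 1}}" using True pm_eq_iff by auto
    qed
  qed
  then show ?thesis using isotropy_group_trivial by simp
qed

end
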